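(* For every $\delta\in(0,1)$ there is a constant $C=C(\delta)>0$ such that the following holds. Let $N\ge1$ and $k\ge1$ be integers. Then for every integer $m\ge \exp(C N^{1/3})$ there is an algorithm (an estimator depending only on $k,N,m$) such that for every choice of distinct $\lambda_1,\dots,\lambda_k\in\{0,1,\dots,N\}$, when given $m$ independent samples from the uniform mixture $\mathcal{M}=\frac1k\sum_{i=1}^k\mathrm{Poi}(\lambda_i)$, it outputs exactly the set $\{\lambda_1,\dots,\lambda_k\}$ with probability at least $1-\delta$.
   Context: $\mathrm{Poi}(\lambda)$ is the Poisson distribution with pmf $e^{-\lambda}\lambda^x/x!$ on $x\in\{0,1,2,\dots\}$; $\mathrm{Poi}(0)$ is the point mass at $0$. The mixture $\frac1k\sum_i f_i$ is the distribution whose pmf is the average of the pmfs of its components. *)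

theory Defs
  imports "HOL-Probability.Probability"
begin

text \<open>The library's \<^const>\<open>poisson_pmf\<close> is specified only for a strictly positive rate,
  so the degenerate case of rate 0 is the point mass at 0 by fiat.\<close>

definition Poi :: "nat \<Rightarrow> nat pmf" where
  "Poi l = (if l = 0 then return_pmf 0 else poisson_pmf (real l))"

lemma pmf_Poi: "pmf (Poi l) x = exp (- real l) * real l ^ x / fact x"
  by (cases "l = 0") (auto simp: Poi_def power_0_left)

definition poisson_mixture :: "nat \<Rightarrow> (nat \<Rightarrow> nat) \<Rightarrow> nat pmf" where
  "poisson_mixture k lam = bind_pmf (pmf_of_set {1..k}) (\<lambda>i. Poi (lam i))"

lemma pmf_poisson_mixture:
  assumes "k \<ge> 1"
  shows "pmf (poisson_mixture k lam) x = (1 / real k) * (\<Sum>i = 1..k. pmf (Poi (lam i)) x)"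
  using assms by (simp add: poisson_mixture_def pmf_bind integral_pmf_of_set)

end

theory Submission
  imports Defs "HOL-Complex_Analysis.Complex_Analysis"
begin

text \<open>
  The generating function of the mixture at \<open>z\<close> is \<open>1/k\<close> times the sum of \<open>w ^ \<lambda>\<^sub>i\<close>, where
  \<open>w = exp (z - 1)\<close>. For two different rate sets the difference of these sums is \<open>w ^ l * q w\<close>, where \<open>q\<close> is
  a polynomial with coefficients in \<open>{-1, 0, 1}\<close> and \<open>\<bar>q 0\<bar> = 1\<close>, so that \<open>\<bar>q w\<bar> \<le> 1 / (1 - \<bar>w\<bar>)\<close> in the unit disc.
  The map \<open>h u = u (1 + u) / 2\<close> fixes 0 and sends the unit circle into the disc, touching the
  circle only at 1, with \<open>\<bar>1 - u\<bar>\<^sup>2 = 4 (1 - \<bar>h u\<bar>\<^sup>2)\<close>. Hence \<open>G u = q (h u) (1 - u)\<^sup>2\<close> is bounded by 8 on the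
  unit circle, and the maximum principle for the product of \<open>n\<close> rotated copies of \<open>G\<close> makes \<open>\<bar>G\<bar>\<close>
  at least \<open>8\<close> to the power \<open>1 - n\<close> somewhere on the arc of half-length \<open>\<pi> / n\<close> around 1. There
  \<open>\<bar>w\<bar> \<ge> 1 - O(1/n\<^sup>2)\<close> and \<open>\<bar>z\<bar> \<le> 1 + O(1/n\<^sup>2)\<close>, so the factor \<open>w ^ l\<close> and the weights \<open>z ^ x\<close> for \<open>x = O(N)\<close> cost
  \<open>exp (O(N/n\<^sup>2))\<close>. Choosing \<open>n\<close> of order \<open>N\<close> to the power \<open>1/3\<close> balances this against \<open>8 ^ n\<close>, and two
  mixtures differ by at least \<open>exp (- O(N powr (1/3)))\<close> at some point \<open>x = O(N)\<close>. The empirical distribution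
  resolves such a difference by Chebyshev's inequality.
\<close>

section \<open>Lower bounds on short arcs from the maximum principle\<close>

text \<open>The product \<open>F\<close> of the rotations of \<open>G\<close> by all n-th roots of
  unity satisfies \<open>norm (F 0) = norm (G 0) ^ n\<close>, so it has modulus at least 1 somewhere
  on the unit circle. One of the rotated points lies on the short arc, and each of the other
  \<open>n - 1\<close> factors is at most \<open>B\<close>.\<close>

lemma entire_large_on_short_arc:
  fixes G :: "complex \<Rightarrow> complex"
  assumes hol: "G holomorphic_on UNIV" and G0: "norm (G 0) \<ge> 1"
    and bound: "\<And>u. norm u = 1 \<Longrightarrow> norm (G u) \<le> B" and n: "n \<ge> 1"
  shows "\<exists>\<phi>. \<bar>\<phi>\<bar> \<le> pi / real n \<and> B ^ (n - 1) * norm (G (cis \<phi>)) \<ge> 1"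
proof -
  define F where "F = (\<lambda>u. \<Prod>j<n. G (u * cis (2 * pi * real j / real n)))"
  have holF: "F holomorphic_on UNIV"
    unfolding F_def
    by (intro holomorphic_on_prod holomorphic_on_compose_gen[OF _ hol, unfolded o_def] holomorphic_intros) auto
  have "1 \<le> norm (F 0)"
    using G0 by (simp add: F_def norm_power)
  have "\<exists>u. norm u = 1 \<and> 1 \<le> norm (F u)"
  proof (rule ccontr)
    assume *: "\<not> ?thesis"
    have "continuous_on (sphere 0 1) (\<lambda>u. norm (F u))"
      by (intro continuous_on_norm holomorphic_on_imp_continuous_on holomorphic_on_subset[OF holF]) auto
    then obtain v where v: "v \<in> sphere 0 1" "\<And>u. u \<in> sphere 0 1 \<Longrightarrow> norm (F u) \<le> norm (F v)"
      using continuous_attains_sup[of "sphere 0 (1::real) :: complex set" "\<lambda>u. norm (F u)"] by auto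
    have "norm (F 0) \<le> norm (F v)"
    proof (rule maximum_modulus_frontier[of F "ball 0 1"])
      show "F holomorphic_on interior (ball 0 1)"
        by (rule holomorphic_on_subset[OF holF]) auto
      show "continuous_on (closure (ball 0 1)) F"
        by (intro holomorphic_on_imp_continuous_on holomorphic_on_subset[OF holF]) auto
      show "norm (F z) \<le> norm (F v)" if "z \<in> frontier (ball 0 1)" for z
        using that v(2) by auto
    qed auto
    with * v(1) \<open>1 \<le> norm (F 0)\<close> show False by auto
  qed
  then obtain u where u: "norm u = 1" "1 \<le> norm (F u)" by blast
  obtain \<theta> where \<theta>: "u = cis \<theta>"
    using u(1) by (metis complex_norm_eq_1_exp cis_conv_exp)
  \<comment> \<open>Rounding to the nearest multiple of \<open>2 * pi / n\<close> leaves the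
    remainder \<open>\<phi>\<close>, of size at most half a step. The rotation wanted is the one by
    \<open>- r\<close> steps; \<open>j\<close> is its index in \<open>{..<n}\<close>.\<close>
  define r where "r = round (\<theta> * real n / (2 * pi))"
  define \<phi> where "\<phi> = \<theta> - 2 * pi * real_of_int r / real n"
  define j where "j = nat ((- r) mod int n)"
  have j: "j < n" using n by (simp add: j_def nat_less_iff)
  have "\<bar>real_of_int r - \<theta> * real n / (2 * pi)\<bar> \<le> 1/2"
    unfolding r_def by (rule of_int_round_abs_le)
  moreover have "\<bar>\<phi>\<bar> = 2 * pi / real n * \<bar>real_of_int r - \<theta> * real n / (2 * pi)\<bar>"
  proof -
    have "\<phi> = 2 * pi / real n * (\<theta> * real n / (2 * pi) - real_of_int r)"
      using n by (simp add: \<phi>_def field_simps)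
    then show ?thesis
      by (simp only: abs_mult abs_minus_commute) simp
  qed
  ultimately have \<phi>: "\<bar>\<phi>\<bar> \<le> pi / real n"
    using n by (simp add: field_simps) 
  have "int n dvd int j + r"
    using n by (simp add: j_def mod_eq_0_iff_dvd[symmetric] mod_add_left_eq)
  then obtain q where q: "int j + r = int n * q" by blast
  have "real j = real n * real_of_int q - real_of_int r"
    using arg_cong[OF q, of real_of_int] by simp
  then have "\<theta> + 2 * pi * real j / real n = \<phi> + 2 * pi * real_of_int q"
    using n by (simp add: \<phi>_def diff_divide_distrib right_diff_distrib)
  then have uj: "u * cis (2 * pi * real j / real n) = cis \<phi>"
    unfolding \<theta> cis_mult by (simp flip: cis_mult)
  have "norm (F u) = norm (G (cis \<phi>)) * (\<Prod>i\<in>{..<n}-{j}. norm (G (u * cis (2 * pi * real i / real n))))"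
    using j uj by (simp add: F_def prod_norm[symmetric] norm_mult prod.remove[of _ j])
  also have "\<dots> \<le> norm (G (cis \<phi>)) * (\<Prod>i\<in>{..<n}-{j}. B)"
    by (intro mult_left_mono prod_mono conjI bound) (auto simp: norm_mult u)
  finally have "1 \<le> B ^ (n - 1) * norm (G (cis \<phi>))"
    using u j by (simp add: mult.commute)
  with \<phi> show ?thesis by blast
qed

lemma norm_power_sum_mult_le_1:
  fixes c :: "nat \<Rightarrow> complex" and w :: complex
  assumes "\<And>i. norm (c i) \<le> 1" and "norm w < 1"
  shows "norm (\<Sum>i\<le>d. c i * w ^ i) * (1 - norm w) \<le> 1"
proof -
  have "norm (\<Sum>i\<le>d. c i * w ^ i) \<le> (\<Sum>i\<le>d. norm w ^ i)"
    using assms(1) by (intro sum_norm_le) (auto simp: norm_mult norm_power intro: mult_left_le_one_le)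
  also have "\<dots> \<le> (\<Sum>i. norm w ^ i)"
    using assms(2) by (intro sum_le_suminf summable_geometric) auto
  also have "\<dots> = 1 / (1 - norm w)"
    using assms(2) by (intro suminf_geometric) auto
  finally show ?thesis
    using assms(2) by (simp add: field_simps)
qed

lemma unit_coeff_poly_large_near_1:
  fixes c :: "nat \<Rightarrow> complex"
  assumes c: "\<And>i. norm (c i) \<le> 1" and c0: "norm (c 0) = 1" and n: "n \<ge> 1"
  shows "\<exists>\<phi>. \<bar>\<phi>\<bar> \<le> pi / real n \<and>
    4 * 8 ^ (n - 1) * norm (\<Sum>i\<le>d. c i * (cis \<phi> * (1 + cis \<phi>) / 2) ^ i) \<ge> 1"
proof -
  define q where "q = (\<lambda>w. \<Sum>i\<le>d. c i * w ^ i)"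
  define G where "G = (\<lambda>u. q (u * (1 + u) / 2) * (1 - u)\<^sup>2)"
  have "G holomorphic_on UNIV"
    unfolding G_def q_def by (intro holomorphic_intros) auto
  moreover have "norm (G 0) \<ge> 1"
  proof -
    have "q 0 = c 0" by (simp add: q_def power_0_left if_distrib cong: if_cong)
    then show ?thesis using c0 by (simp add: G_def)
  qed
  moreover have "norm (G u) \<le> 8" if u: "norm u = 1" for u
  proof -
    define r where "r = norm (u * (1 + u) / 2)"
    have r: "r = norm (1 + u) / 2" using u by (simp add: r_def norm_mult norm_divide)
    \<comment> \<open>The parallelogram law turns \<open>(norm (1 - u))\<^sup>2\<close> into a
      multiple of \<open>1 - r\<close>, which is exactly what cancels the blow-up
      \<open>1 / (1 - r)\<close> of the bound on \<open>q\<close>.\<close>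
    have par: "(norm (1 + u))\<^sup>2 + (norm (1 - u))\<^sup>2 = 4"
    proof -
      have "(Re u)\<^sup>2 + (Im u)\<^sup>2 = 1"
        using u cmod_power2[of u] by simp
      then show ?thesis
        unfolding cmod_power2 by (simp add: power2_sum power2_diff)
    qed
    then have eq: "(norm (1 - u))\<^sup>2 = 4 * (1 - r) * (1 + r)"
      by (simp add: r power2_eq_square algebra_simps)
    have "r \<le> 1" using norm_triangle_ineq[of 1 u] u by (simp add: r)
    show ?thesis
    proof (cases "r = 1")
      case True
      then show ?thesis using eq by (simp add: G_def)
    next
      case False
      with \<open>r \<le> 1\<close> have "r < 1" by simp
      then have "norm (q (u * (1 + u) / 2)) * (1 - r) \<le> 1"
        using norm_power_sum_mult_le_1[OF c, where w = "u * (1 + u) / 2" and d = d] by (simp add: q_def r_def)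
      moreover have "0 \<le> r" by (simp add: r_def)
      ultimately have "(norm (q (u * (1 + u) / 2)) * (1 - r)) * (4 * (1 + r)) \<le> 1 * 8"
        using \<open>r \<le> 1\<close> by (intro mult_mono) auto
      moreover have "norm (G u) = (norm (q (u * (1 + u) / 2)) * (1 - r)) * (4 * (1 + r))"
        unfolding G_def norm_mult norm_power eq by (simp only: mult_ac)
      ultimately show ?thesis by simp
    qed
  qed
  ultimately obtain \<phi> where \<phi>: "\<bar>\<phi>\<bar> \<le> pi / real n" "8 ^ (n - 1) * norm (G (cis \<phi>)) \<ge> 1"
    using entire_large_on_short_arc[of G 8 n] n by blast
  \<comment> \<open>Removing the factor \<open>(1 - u)\<^sup>2\<close> from \<open>G\<close> costs
    the 4 of the statement.\<close>
  have "norm (1 - cis \<phi>) \<le> 2" using norm_triangle_ineq4[of 1 "cis \<phi>"] by simp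
  then have "(norm (1 - cis \<phi>))\<^sup>2 \<le> 2\<^sup>2" by (intro power_mono) auto
  then have "norm (G (cis \<phi>)) \<le> norm (q (cis \<phi> * (1 + cis \<phi>) / 2)) * 4"
    unfolding G_def norm_mult norm_power by (intro mult_left_mono) auto
  then have "8 ^ (n - 1) * norm (G (cis \<phi>)) \<le> 8 ^ (n - 1) * (norm (q (cis \<phi> * (1 + cis \<phi>) / 2)) * 4)"
    by (intro mult_left_mono) auto
  with \<phi>(2) have "1 \<le> 8 ^ (n - 1) * (norm (q (cis \<phi> * (1 + cis \<phi>) / 2)) * 4)"
    by (rule order.trans)
  then have "4 * 8 ^ (n - 1) * norm (q (cis \<phi> * (1 + cis \<phi>) / 2)) \<ge> 1"
    by (simp only: mult_ac)
  with \<phi>(1) show ?thesis unfolding q_def by blast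
qed

section \<open>Generating functions of Poisson sums\<close>

text \<open>The exponential series at \<open>a * z\<close>. The general field allows both a complex
  \<open>z\<close>, where the mixtures are compared, and a real argument, which serves to bound
  tails.\<close>

lemma sums_pmf_Poi_mult_power:
  fixes z :: "'a :: {real_normed_field, banach}"
  shows "(\<lambda>x. of_real (pmf (Poi a) x) * z ^ x) sums (exp (z - 1) ^ a)"
proof -
  have "(\<lambda>x. of_real (exp (- real a)) * ((of_nat a * z) ^ x /\<^sub>R fact x))
      sums (of_real (exp (- real a)) * exp (of_nat a * z))"
    by (intro sums_mult exp_converges)
  also have "(\<lambda>x. of_real (exp (- real a)) * ((of_nat a * z) ^ x /\<^sub>R fact x))
      = (\<lambda>x. of_real (pmf (Poi a) x) * z ^ x)"
    by (simp add: pmf_Poi scaleR_conv_of_real power_mult_distrib field_simps)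
  also have "of_real (exp (- real a)) * exp (of_nat a * z) = exp (of_nat a * (z - 1))"
    by (simp add: exp_of_real[symmetric] exp_add[symmetric] algebra_simps)
  also have "\<dots> = exp (z - 1) ^ a"
    by (rule exp_of_nat_mult)
  finally show ?thesis .
qed

lemma power_sum_diff_large_near_1:
  fixes A B :: "nat set"
  assumes A: "A \<subseteq> {0..N}" and B: "B \<subseteq> {0..N}" and "A \<noteq> B" and n: "n \<ge> 1"
  shows "\<exists>\<phi> l. \<bar>\<phi>\<bar> \<le> pi / real n \<and> l \<le> N \<and>
    (let w = cis \<phi> * (1 + cis \<phi>) / 2 in
      norm w ^ l \<le> 4 * 8 ^ (n - 1) * norm ((\<Sum>a\<in>A. w ^ a) - (\<Sum>b\<in>B. w ^ b)))"
proof -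
  define e where "e = (\<lambda>j. of_bool (j \<in> A) - of_bool (j \<in> B) :: complex)"
  \<comment> \<open>The smallest element of the symmetric difference of \<open>A\<close> and
    \<open>B\<close>: taking out \<open>w ^ l\<close> leaves a polynomial with constant term 1 or
    -1.\<close>
  define l where "l = (LEAST j. e j \<noteq> 0)"
  obtain j where j: "e j \<noteq> 0" "j \<le> N"
    using assms(1-3) by (force simp: e_def)
  have el: "e l \<noteq> 0" unfolding l_def using j(1) by (rule LeastI)
  have "l \<le> N" using Least_le[of "\<lambda>j. e j \<noteq> 0" j] j by (simp add: l_def)
  have below: "e j = 0" if "j < l" for j
    using that not_less_Least unfolding l_def by blast
  have above: "e j = 0" if "j > N" for j
    using that A B by (auto simp: e_def)
  have eq: "(\<Sum>a\<in>A. w ^ a) - (\<Sum>b\<in>B. w ^ b) = w ^ l * (\<Sum>i\<le>N. e (i + l) * w ^ i)" for w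
  proof -
    have S: "(\<Sum>a\<in>S. w ^ a) = (\<Sum>j=0..N. of_bool (j \<in> S) * w ^ j)" if "S \<subseteq> {0..N}" for S
      using that by (intro sum.mono_neutral_cong_left) auto
    have "(\<Sum>a\<in>A. w ^ a) - (\<Sum>b\<in>B. w ^ b) = (\<Sum>j=0..N. e j * w ^ j)"
      unfolding S[OF A] S[OF B] e_def by (simp only: sum_subtractf[symmetric] left_diff_distrib)
    \<comment> \<open>Padding with zero terms up to \<open>N + l\<close> makes the shifted sum run
      over \<open>0..N\<close> whatever \<open>l\<close> is.\<close>
    also have "\<dots> = (\<Sum>j=0..N + l. e j * w ^ j)"
      by (intro sum.mono_neutral_left) (auto simp: above)
    also have "\<dots> = (\<Sum>j=0 + l..N + l. e j * w ^ j)"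
      by (intro sum.mono_neutral_right) (auto simp: below)
    also have "\<dots> = (\<Sum>i=0..N. e (i + l) * w ^ (i + l))"
      by (rule sum.shift_bounds_cl_nat_ivl)
    also have "\<dots> = w ^ l * (\<Sum>i\<le>N. e (i + l) * w ^ i)"
      by (simp add: sum_distrib_left atLeast0AtMost power_add mult_ac)
    finally show ?thesis .
  qed
  have "norm (e (i + l)) \<le> 1" for i by (auto simp: e_def)
  moreover have "norm (e (0 + l)) = 1" using el by (auto simp: e_def of_bool_def split: if_splits)
  ultimately obtain \<phi> where \<phi>: "\<bar>\<phi>\<bar> \<le> pi / real n"
      "4 * 8 ^ (n - 1) * norm (\<Sum>i\<le>N. e (i + l) * (cis \<phi> * (1 + cis \<phi>) / 2) ^ i) \<ge> 1"
    using unit_coeff_poly_large_near_1[of "\<lambda>i. e (i + l)" n N] n by blast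
  define w where "w = cis \<phi> * (1 + cis \<phi>) / 2"
  have "norm w ^ l * 1 \<le> norm w ^ l * (4 * 8 ^ (n - 1) * norm (\<Sum>i\<le>N. e (i + l) * w ^ i))"
    using \<phi>(2) unfolding w_def by (intro mult_left_mono) auto
  also have "\<dots> = 4 * 8 ^ (n - 1) * norm ((\<Sum>a\<in>A. w ^ a) - (\<Sum>b\<in>B. w ^ b))"
    unfolding eq norm_mult norm_power by (simp only: mult_ac)
  finally show ?thesis
    using \<phi>(1) \<open>l \<le> N\<close> unfolding w_def Let_def by auto
qed

text \<open>Pulls the bound on the arc back along \<open>w = exp (z - 1)\<close>. With
  \<open>s = \<phi> / 2\<close> one has \<open>w = cos s * cis (3 * s)\<close>. Its modulus is below
  1 only to second order in \<open>s\<close>; the real part of \<open>z\<close> lies in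
  \<open>[0, 1]\<close> and its imaginary part is \<open>3 * s\<close>, so \<open>norm z\<close>
  exceeds 1 only to second order as well.\<close>

lemma exp_power_sum_diff_large:
  fixes A B :: "nat set"
  assumes A: "A \<subseteq> {0..N}" and B: "B \<subseteq> {0..N}" and "A \<noteq> B" and n: "n \<ge> 2"
  shows "\<exists>z::complex. norm z \<le> 4 \<and> norm z \<le> exp (18 / (real n)\<^sup>2) \<and>
    exp (- 4 * real N / (real n)\<^sup>2)
      \<le> 4 * 8 ^ (n - 1) * norm ((\<Sum>a\<in>A. exp (z - 1) ^ a) - (\<Sum>b\<in>B. exp (z - 1) ^ b))"
proof -
  obtain \<phi> l where \<phi>: "\<bar>\<phi>\<bar> \<le> pi / real n" and l: "l \<le> N" and
    large: "norm (cis \<phi> * (1 + cis \<phi>) / 2) ^ l \<le> 4 * 8 ^ (n - 1) *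
      norm ((\<Sum>a\<in>A. (cis \<phi> * (1 + cis \<phi>) / 2) ^ a) - (\<Sum>b\<in>B. (cis \<phi> * (1 + cis \<phi>) / 2) ^ b))"
    using power_sum_diff_large_near_1[OF assms(1-3), of n] n by (auto simp: Let_def)
  define s where "s = \<phi> / 2"
  define N2 where "N2 = (real n)\<^sup>2"
  have N2: "N2 \<ge> 4" using power_mono[of 2 "real n" 2] n by (simp add: N2_def)
  have "\<bar>s\<bar> \<le> 2 / real n"
    using \<phi> divide_right_mono[of pi 4 "real n"] pi_less_4 by (simp add: s_def)
  then have "s\<^sup>2 \<le> (2 / real n)\<^sup>2" by (metis abs_ge_zero power2_abs power_mono)
  then have s2: "s\<^sup>2 \<le> 4 / N2" by (simp add: power_divide N2_def)
  moreover have "4 / N2 \<le> 1" using N2 by simp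
  ultimately have s1: "s\<^sup>2 \<le> 1" by simp
  define t where "t = s\<^sup>2 / 2"
  have t: "0 \<le> t" "t \<le> 1/2" using s1 by (auto simp: t_def)
  have "(sin (s / 2))\<^sup>2 \<le> (s / 2)\<^sup>2"
    using abs_sin_x_le_abs_x[of "s / 2"] abs_le_square_iff by blast
  then have cos_ge: "cos s \<ge> 1 - t"
    using cos_double_sin[of "s / 2"] by (simp add: t_def power_divide)
  then have cos_pos: "cos s > 0" using t by simp
  \<comment> \<open>Because \<open>t \<le> 1/2\<close>, the quadratic term is at most
    \<open>t\<close>, and \<open>2 * t = s\<^sup>2 \<le> 4 / N2\<close>.\<close>
  have "- 4 / N2 \<le> - t - 2 * t\<^sup>2"
  proof -
    have "t * t \<le> t * (1/2)" using t by (intro mult_left_mono) auto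
    then have "- 2 * t \<le> - t - 2 * t\<^sup>2" by (simp add: power2_eq_square)
    then show ?thesis using s2 by (simp add: t_def)
  qed
  also have "\<dots> \<le> ln (1 - t)" using t by (intro ln_one_minus_pos_lower_bound)
  also have "\<dots> \<le> ln (cos s)" using cos_ge t by simp
  finally have ln_ge: "- 4 / N2 \<le> ln (cos s)" .
  then have ln_ge_1: "-1 \<le> ln (cos s)" using \<open>4 / N2 \<le> 1\<close> by simp
  have ln_le: "ln (cos s) \<le> 0" using cos_pos by simp

  \<comment> \<open>This is 1 plus the logarithm of \<open>w\<close> with argument
    \<open>3 * s\<close>.\<close>
  define z where "z = Complex (1 + ln (cos s)) (3 * s)"
  have w: "exp (z - 1) = cis \<phi> * (1 + cis \<phi>) / 2"
  proof -
    have "exp (z - 1) = complex_of_real (cos s) * cis (3 * s)"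
      using cos_pos by (simp add: z_def exp_eq_polar Complex_eq_1)
    also have "\<dots> = cis (2 * s) * (1 + cis (2 * s)) / 2"
    proof -
      have "complex_of_real (cos s) = (cis (- s) + cis s) / 2"
        by (simp add: complex_eq_iff)
      moreover have "cis (- s) * cis (3 * s) = cis (2 * s)" "cis s * cis (3 * s) = cis (2 * s) * cis (2 * s)"
        by (simp_all add: cis_mult)
      ultimately show ?thesis by (simp add: algebra_simps add_divide_distrib)
    qed
    finally show ?thesis by (simp add: s_def)
  qed
  have "(1 + ln (cos s))\<^sup>2 \<le> 1\<^sup>2"
    using ln_le ln_ge_1 by (intro power_mono) auto
  then have nz: "(norm z)\<^sup>2 \<le> 1 + 36 / N2"
    using s2 by (simp add: z_def cmod_power2 power_mult_distrib)
  have "36 / N2 \<le> 9" using N2 by (simp add: field_simps)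
  then have "(norm z)\<^sup>2 \<le> 4\<^sup>2" using nz by simp
  then have "norm z \<le> 4" by (rule power2_le_imp_le) simp
  moreover have "norm z \<le> exp (18 / N2)"
  proof (rule power2_le_imp_le)
    note nz
    also have "1 + 36 / N2 \<le> exp (36 / N2)" by (rule exp_ge_add_one_self)
    also have "\<dots> = (exp (18 / N2))\<^sup>2" by (subst exp_double[symmetric]) simp
    finally show "(norm z)\<^sup>2 \<le> (exp (18 / N2))\<^sup>2" .
  qed simp
  moreover have "exp (- 4 * real N / N2) \<le> norm (exp (z - 1)) ^ l"
  proof -
    have norm_w: "norm (exp (z - 1)) = cos s"
      using cos_pos by (simp add: z_def)
    have "exp (- 4 * real N / N2) = exp (real N * (- 4 / N2))" by simp
    also have "\<dots> = exp (- 4 / N2) ^ N" by (rule exp_of_nat_mult)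
    also have "\<dots> \<le> cos s ^ N"
      using ln_ge cos_pos by (intro power_mono) (simp_all add: ln_ge_iff)
    also have "\<dots> \<le> cos s ^ l"
      using cos_pos l by (intro power_decreasing) auto
    finally show ?thesis by (simp only: norm_w)
  qed
  ultimately show ?thesis
    using large unfolding w[symmetric] N2_def[symmetric] by (intro exI[of _ z]) auto
qed

section \<open>Concentration of empirical frequencies\<close>

lemma nn_integral_two_valued:
  fixes p :: "'a pmf" and u v :: real
  assumes "u \<ge> 0" "v \<ge> 0"
  shows "(\<integral>\<^sup>+ x. ennreal (if x = y then u else v) \<partial>measure_pmf p)
    = ennreal (pmf p y * u + (1 - pmf p y) * v)"
proof -
  have "(\<integral>\<^sup>+ x. ennreal (if x = y then u else v) \<partial>measure_pmf p)
    = (\<integral>\<^sup>+ b. ennreal (if b then u else v) \<partial>measure_pmf (map_pmf (\<lambda>x. x = y) p))"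
    by simp
  also have "map_pmf (\<lambda>x. x = y) p = bernoulli_pmf (pmf p y)"
  proof (rule pmf_eqI)
    fix b
    have "pmf (map_pmf (\<lambda>x. x = y) p) True = pmf p y"
      by (simp add: pmf_map vimage_def measure_pmf_single)
    moreover have "pmf (map_pmf (\<lambda>x. x = y) p) False = 1 - pmf (map_pmf (\<lambda>x. x = y) p) True"
      by (rule pmf_False_conv_True)
    ultimately show "pmf (map_pmf (\<lambda>x. x = y) p) b = pmf (bernoulli_pmf (pmf p y)) b"
      by (cases b) (auto simp: pmf_le_1)
  qed
  finally show ?thesis
    using assms by (simp add: pmf_le_1 ennreal_mult' mult.commute)
qed

text \<open>At \<open>a = 0\<close> this is the binomial variance. The shift \<open>a\<close> makes
  the induction go through: the first sample changes it by \<open>1 - pmf p y\<close> or by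
  \<open>- pmf p y\<close>, and these changes have mean zero.\<close>

lemma nn_integral_count_list_shifted_square:
  fixes p :: "'a pmf"
  shows "(\<integral>\<^sup>+ xs. ennreal ((a + (real (count_list xs y) - real m * pmf p y))\<^sup>2)
    \<partial>measure_pmf (replicate_pmf m p)) = ennreal (a\<^sup>2 + real m * (pmf p y * (1 - pmf p y)))"
proof (induction m arbitrary: a)
  case 0
  show ?case by simp
next
  case (Suc m)
  define q where "q = pmf p y"
  have q: "0 \<le> q" "q \<le> 1" by (auto simp: q_def pmf_le_1)
  define v where "v = real m * (q * (1 - q))"
  have v: "v \<ge> 0" using q by (simp add: v_def)
  have "(\<integral>\<^sup>+ xs. ennreal ((a + (real (count_list xs y) - real (Suc m) * q))\<^sup>2)
      \<partial>measure_pmf (replicate_pmf (Suc m) p))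
    = (\<integral>\<^sup>+ x. \<integral>\<^sup>+ xs. ennreal (((a + (if x = y then 1 else 0) - q) + (real (count_list xs y) - real m * q))\<^sup>2)
      \<partial>measure_pmf (replicate_pmf m p) \<partial>measure_pmf p)"
    by (simp, intro nn_integral_cong arg_cong[where f = ennreal]) (auto simp: algebra_simps)
  also have "\<dots> = (\<integral>\<^sup>+ x. ennreal ((a + (if x = y then 1 else 0) - q)\<^sup>2 + v) \<partial>measure_pmf p)"
    using Suc.IH by (simp add: q_def v_def)
  also have "\<dots> = (\<integral>\<^sup>+ x. ennreal (if x = y then (a + 1 - q)\<^sup>2 + v else (a - q)\<^sup>2 + v) \<partial>measure_pmf p)"
    by (intro nn_integral_cong) auto
  also have "\<dots> = ennreal (q * ((a + 1 - q)\<^sup>2 + v) + (1 - q) * ((a - q)\<^sup>2 + v))"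
    unfolding q_def[symmetric] using v by (subst nn_integral_two_valued) (auto simp: q_def)
  also have "q * ((a + 1 - q)\<^sup>2 + v) + (1 - q) * ((a - q)\<^sup>2 + v) = a\<^sup>2 + real (Suc m) * (q * (1 - q))"
    by (simp add: v_def power2_eq_square algebra_simps)
  finally show ?case by (simp only: q_def)
qed

text \<open>Chebyshev's inequality. The factor \<open>pmf p y\<close> is kept because it sums to at
  most 1 over \<open>y\<close>, so the later union bound does not depend on the number of
  points.\<close>

lemma prob_count_list_deviation:
  fixes p :: "'a pmf"
  assumes \<eta>: "\<eta> > 0" and m: "m \<ge> 1"
  shows "measure_pmf.prob (replicate_pmf m p) {xs. \<bar>real (count_list xs y) / real m - pmf p y\<bar> \<ge> \<eta>}
    \<le> pmf p y / (real m * \<eta>\<^sup>2)"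
proof -
  let ?R = "replicate_pmf m p" and ?q = "pmf p y"
  let ?E = "{xs. \<bar>real (count_list xs y) / real m - ?q\<bar> \<ge> \<eta>}"
  let ?f = "\<lambda>xs. ennreal ((real (count_list xs y) - real m * ?q)\<^sup>2)"
  have E: "1 \<le> ennreal (1 / (real m * \<eta>)\<^sup>2) * ?f xs" if "xs \<in> ?E" for xs
  proof -
    have "real m * \<eta> \<le> \<bar>real (count_list xs y) - real m * ?q\<bar>"
      using that m by (simp add: field_simps abs_if split: if_splits)
    then have "(real m * \<eta>)\<^sup>2 \<le> (real (count_list xs y) - real m * ?q)\<^sup>2"
      using \<eta> by (simp add: abs_le_square_iff[symmetric])
    then have "1 \<le> 1 / (real m * \<eta>)\<^sup>2 * (real (count_list xs y) - real m * ?q)\<^sup>2"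
      using \<eta> m by (simp add: field_simps)
    then show ?thesis by (simp add: ennreal_mult'[symmetric] ennreal_1[symmetric] del: ennreal_1)
  qed
  have "emeasure (measure_pmf ?R) ?E
      \<le> emeasure (measure_pmf ?R) {xs \<in> UNIV. 1 \<le> ennreal (1 / (real m * \<eta>)\<^sup>2) * ?f xs}"
    using E by (intro emeasure_mono) auto
  also have "\<dots> \<le> ennreal (1 / (real m * \<eta>)\<^sup>2) * (\<integral>\<^sup>+ xs. ?f xs * indicator UNIV xs \<partial>measure_pmf ?R)"
    by (intro nn_integral_Markov_inequality) auto
  also have "\<dots> = ennreal (1 / (real m * \<eta>)\<^sup>2) * ennreal (real m * (?q * (1 - ?q)))"
    using nn_integral_count_list_shifted_square[where a = 0 and y = y and m = m and p = p] by simp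
  also have "\<dots> = ennreal (?q * (1 - ?q) / (real m * \<eta>\<^sup>2))"
    using m \<eta> by (subst ennreal_mult[symmetric])
      (auto simp: power_mult_distrib power2_eq_square pmf_le_1 mult_ac)
  also have "\<dots> \<le> ennreal (?q / (real m * \<eta>\<^sup>2))"
    by (intro ennreal_leI divide_right_mono mult_left_le) (auto simp: pmf_le_1)
  finally show ?thesis
    by (simp add: measure_pmf.emeasure_eq_measure)
qed

lemma prob_empirical_pmf_close:
  fixes p :: "'a pmf"
  assumes \<eta>: "\<eta> > 0" and m: "m \<ge> 1" and fin: "finite A"
  shows "measure_pmf.prob (replicate_pmf m p) {xs. \<forall>y\<in>A. \<bar>real (count_list xs y) / real m - pmf p y\<bar> < \<eta>}
    \<ge> 1 - 1 / (real m * \<eta>\<^sup>2)"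
proof -
  let ?P = "measure_pmf.prob (replicate_pmf m p)"
  let ?E = "\<lambda>y. {xs. \<bar>real (count_list xs y) / real m - pmf p y\<bar> \<ge> \<eta>}"
  have "?P (\<Union>y\<in>A. ?E y) \<le> (\<Sum>y\<in>A. ?P (?E y))"
    using fin by (intro measure_pmf.finite_measure_subadditive_finite) auto
  also have "\<dots> \<le> (\<Sum>y\<in>A. pmf p y / (real m * \<eta>\<^sup>2))"
    by (intro sum_mono prob_count_list_deviation \<eta> m)
  also have "\<dots> = measure_pmf.prob p A / (real m * \<eta>\<^sup>2)"
    using fin by (simp add: sum_divide_distrib measure_measure_pmf_finite)
  also have "\<dots> \<le> 1 / (real m * \<eta>\<^sup>2)"
    by (intro divide_right_mono) auto
  finally have "1 - 1 / (real m * \<eta>\<^sup>2) \<le> 1 - ?P (\<Union>y\<in>A. ?E y)" by simp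
  also have "\<dots> = ?P (- (\<Union>y\<in>A. ?E y))"
    by (simp add: measure_pmf.prob_compl[symmetric] Compl_eq_Diff_UNIV)
  also have "- (\<Union>y\<in>A. ?E y) = {xs. \<forall>y\<in>A. \<bar>real (count_list xs y) / real m - pmf p y\<bar> < \<eta>}"
    by (auto simp: not_le)
  finally show ?thesis .
qed

section \<open>Separation of the mixtures\<close>

text \<open>If all differences up to \<open>26 * N\<close> were smaller, the difference
  \<open>V\<close> of the generating functions at the chosen \<open>z\<close> would fall below its
  lower bound \<open>exp (- 12 * T)\<close>: the head of the series is then small by assumption, and
  its tail by Poisson decay.\<close>

lemma Poi_sums_differ:
  fixes A B :: "nat set" and N :: nat
  defines "T \<equiv> real N powr (1/3)"
  assumes A: "A \<subseteq> {0..N}" and B: "B \<subseteq> {0..N}" and AB: "A \<noteq> B" and N: "N \<ge> 1"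
  shows "\<exists>x\<le>26 * N. exp (- 490 * T) \<le> \<bar>(\<Sum>a\<in>A. pmf (Poi a) x) - (\<Sum>b\<in>B. pmf (Poi b) x)\<bar>"
proof (rule ccontr)
  define K where "K = 26 * N"
  define D where "D = (\<lambda>x. (\<Sum>a\<in>A. pmf (Poi a) x) - (\<Sum>b\<in>B. pmf (Poi b) x))"
  define P where "P = (\<lambda>x. (\<Sum>a\<in>A. pmf (Poi a) x) + (\<Sum>b\<in>B. pmf (Poi b) x))"
  assume "\<not> ?thesis"
  then have small: "\<bar>D x\<bar> \<le> exp (- 490 * T)" if "x \<le> K" for x
    using that unfolding D_def K_def by (meson less_imp_le not_le)
  have T1: "T \<ge> 1" using N by (simp add: T_def ge_one_powr_ge_zero)
  have T3: "T ^ 3 = real N" using N by (simp add: T_def powr_powr flip: powr_numeral)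
  have TN: "T \<le> real N" using power_increasing[of 1 3 T] T1 T3 by simp
  have exp1: "2 \<le> exp (1::real)" using exp_ge_add_one_self[of 1] by linarith
  \<comment> \<open>With \<open>n\<close> of order \<open>T\<close>, both \<open>8 ^ (n - 1)\<close>
    and \<open>exp (N / n\<^sup>2)\<close> are \<open>exp (O(T))\<close>, since
    \<open>N = T ^ 3\<close>.\<close>
  define n where "n = nat \<lceil>T\<rceil> + 1"
  have n: "n \<ge> 2" using T1 unfolding n_def by linarith
  have nT: "T \<le> real n" "real (n - 1) \<le> 2 * T" using T1 unfolding n_def by linarith+
  have Nn: "real N / (real n)\<^sup>2 \<le> T"
  proof -
    have "real N \<le> T * (real n)\<^sup>2"
      unfolding T3[symmetric] power3_eq_cube power2_eq_square mult.assoc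
      using nT T1 by (intro mult_left_mono mult_mono) auto
    then show ?thesis using n by (simp add: field_simps)
  qed

  obtain z :: complex where z4: "norm z \<le> 4" and zn: "norm z \<le> exp (18 / (real n)\<^sup>2)" and
    large: "exp (- 4 * real N / (real n)\<^sup>2) \<le> 4 * 8 ^ (n - 1) *
      norm ((\<Sum>a\<in>A. exp (z - 1) ^ a) - (\<Sum>b\<in>B. exp (z - 1) ^ b))"
    using exp_power_sum_diff_large[OF A B AB n] by blast
  define V where "V = (\<Sum>a\<in>A. exp (z - 1) ^ a) - (\<Sum>b\<in>B. exp (z - 1) ^ b)"
  have "exp (- 12 * T) \<le> norm V"
  proof -
    have "4 \<le> exp (1::real) ^ 2" using power_mono[OF exp1, of 2] by simp
    also have "\<dots> = exp 2" by (simp flip: exp_of_nat_mult)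
    also have "\<dots> \<le> exp (2 * T)" using T1 by simp
    finally have e4: "4 \<le> exp (2 * T)" .
    have "8 \<le> exp (1::real) ^ 3" using power_mono[OF exp1, of 3] by simp
    also have "\<dots> = exp 3" by (simp flip: exp_of_nat_mult)
    finally have "(8::real) ^ (n - 1) \<le> exp 3 ^ (n - 1)" by (intro power_mono) auto
    also have "\<dots> = exp (real (n - 1) * 3)" by (rule exp_of_nat_mult[symmetric])
    also have "\<dots> \<le> exp (6 * T)" using nT by simp
    finally have e8: "(8::real) ^ (n - 1) \<le> exp (6 * T)" .
    have "exp (- 4 * T) \<le> exp (- 4 * real N / (real n)\<^sup>2)" using Nn by simp
    also have "\<dots> \<le> 4 * 8 ^ (n - 1) * norm V" using large by (simp add: V_def)
    also have "\<dots> \<le> exp (2 * T) * exp (6 * T) * norm V"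
      using e4 e8 by (intro mult_right_mono mult_mono) auto
    finally have "exp (- 8 * T) * exp (- 4 * T) \<le> exp (- 8 * T) * (exp (8 * T) * norm V)"
      by (intro mult_left_mono) (auto simp: exp_add[symmetric])
    then show ?thesis by (simp add: mult.assoc[symmetric] exp_add[symmetric])
  qed

  \<comment> \<open>The summed generating functions at the real point \<open>4 * exp 1\<close>. For
    \<open>x > K\<close> the weight \<open>norm z ^ x \<le> 4 ^ x\<close> is at most
    \<open>exp (- K) * (4 * exp 1) ^ x\<close>, so \<open>exp (- K) * W\<close> bounds the
    tail.\<close>
  define W where "W = (\<Sum>a\<in>A. exp (exp 1 * 4 - 1) ^ a) + (\<Sum>b\<in>B. exp (exp 1 * 4 - 1 :: real) ^ b)"
  define \<rho> where "\<rho> = exp (18 / (real n)\<^sup>2)"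
  define g where "g = (\<lambda>x. (if x \<in> {..K} then exp (- 490 * T) * \<rho> ^ K else 0)
    + exp (- real K) * (P x * (exp 1 * 4) ^ x))"
  have sums_V: "(\<lambda>x. of_real (D x) * z ^ x) sums V"
  proof -
    have "(\<lambda>x. (\<Sum>a\<in>A. of_real (pmf (Poi a) x) * z ^ x) - (\<Sum>b\<in>B. of_real (pmf (Poi b) x) * z ^ x)) sums V"
      unfolding V_def by (intro sums_diff sums_sum sums_pmf_Poi_mult_power)
    then show ?thesis by (simp add: D_def left_diff_distrib sum_distrib_right)
  qed
  have sums_g: "g sums ((\<Sum>x\<in>{..K}. exp (- 490 * T) * \<rho> ^ K) + exp (- real K) * W)"
  proof -
    have "(\<lambda>x. (\<Sum>a\<in>A. of_real (pmf (Poi a) x) * (exp 1 * 4) ^ x)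
        + (\<Sum>b\<in>B. of_real (pmf (Poi b) x) * (exp 1 * 4 :: real) ^ x)) sums W"
      unfolding W_def by (intro sums_add sums_sum sums_pmf_Poi_mult_power)
    then have "(\<lambda>x. P x * (exp 1 * 4) ^ x) sums W"
      by (simp add: P_def distrib_right sum_distrib_right)
    then show ?thesis
      unfolding g_def by (intro sums_add sums_mult sums_If_finite_set) auto
  qed
  have le_g: "norm (of_real (D x) * z ^ x) \<le> g x" for x
  proof (cases "x \<le> K")
    case True
    have "P x \<ge> 0" by (simp add: P_def sum_nonneg)
    have "norm z ^ x \<le> \<rho> ^ x" using zn by (intro power_mono) (auto simp: \<rho>_def)
    also have "\<dots> \<le> \<rho> ^ K" using True by (intro power_increasing) (auto simp: \<rho>_def)
    finally have "\<bar>D x\<bar> * norm z ^ x \<le> exp (- 490 * T) * \<rho> ^ K"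
      using small[OF True] by (intro mult_mono) auto
    then show ?thesis
      using True \<open>P x \<ge> 0\<close> by (simp add: g_def norm_mult norm_power add_increasing2)
  next
    case False
    have "\<bar>D x\<bar> \<le> P x"
      unfolding D_def P_def
      by (rule order.trans[OF abs_triangle_ineq4]) (simp add: sum_nonneg)
    moreover have "norm z ^ x \<le> exp (- real K) * (exp 1 * 4) ^ x"
    proof -
      have "norm z ^ x \<le> 1 * 4 ^ x" using z4 by (simp add: power_mono)
      also have "\<dots> \<le> exp (real x - real K) * 4 ^ x" using False by (intro mult_right_mono) auto
      also have "\<dots> = exp (- real K) * (exp 1 * 4) ^ x"
        by (simp add: power_mult_distrib exp_of_nat_mult[symmetric] exp_diff exp_minus field_simps)
      finally show ?thesis .
    qed
    ultimately have "\<bar>D x\<bar> * norm z ^ x \<le> P x * (exp (- real K) * (exp 1 * 4) ^ x)"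
      by (intro mult_mono) auto
    then show ?thesis
      using False by (simp add: g_def norm_mult norm_power mult_ac)
  qed
  have "norm V \<le> (\<Sum>x\<in>{..K}. exp (- 490 * T) * \<rho> ^ K) + exp (- real K) * W"
    by (rule norm_sums_le[OF sums_V sums_g le_g])
  \<comment> \<open>The constant is 490 = 14 + 8 + 468: the number of terms costs 8, and
    \<open>\<rho> ^ K\<close> costs 468 = 18 * 26.\<close>
  also have "(\<Sum>x\<in>{..K}. exp (- 490 * T) * \<rho> ^ K) \<le> exp (- 14 * T)"
  proof -
    have "real (K + 1) \<le> 27 * real N" using N by (simp add: K_def)
    also have "\<dots> \<le> exp (5 * T) * exp (3 * T)"
    proof (rule mult_mono)
      have "27 \<le> exp (1::real) ^ 5" using power_mono[OF exp1, of 5] by simp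
      also have "\<dots> = exp 5" by (simp flip: exp_of_nat_mult)
      also have "\<dots> \<le> exp (5 * T)" using T1 by simp
      finally show "27 \<le> exp (5 * T)" .
      have "T ^ 3 \<le> exp T ^ 3" using T1 exp_ge_add_one_self[of T] by (intro power_mono) linarith+
      then show "real N \<le> exp (3 * T)" by (simp add: T3 flip: exp_of_nat_mult)
    qed auto
    finally have K1: "real (K + 1) \<le> exp (8 * T)" by (simp add: exp_add[symmetric])
    have "\<rho> ^ K = exp (468 * (real N / (real n)\<^sup>2))"
      by (simp add: \<rho>_def exp_of_nat_mult[symmetric] K_def)
    also have "\<dots> \<le> exp (468 * T)" using Nn by simp
    finally have "real (K + 1) * (exp (- 490 * T) * \<rho> ^ K) \<le> exp (8 * T) * (exp (- 490 * T) * exp (468 * T))"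
      using K1 by (intro mult_mono) (auto simp: \<rho>_def)
    then show ?thesis by (simp add: exp_add[symmetric])
  qed
  \<comment> \<open>As \<open>exp 1 \<le> 3\<close>, the exponent \<open>4 * exp 1 - 1\<close> is at
    most 11, and \<open>W \<le> exp (13 * N)\<close>. The cutoff \<open>K = 26 * N\<close> is twice
    that exponent.\<close>
  also have "exp (- real K) * W \<le> exp (- 13 * real N)"
  proof -
    have S: "(\<Sum>a\<in>S. exp (exp 1 * 4 - 1 :: real) ^ a) \<le> (real N + 1) * exp (11 * real N)" if "S \<subseteq> {0..N}" for S
    proof -
      have "(\<Sum>a\<in>S. exp (exp 1 * 4 - 1 :: real) ^ a) \<le> (\<Sum>a\<in>{0..N}. exp (exp 1 * 4 - 1 :: real) ^ a)"
        using that by (intro sum_mono2) auto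
      also have "\<dots> \<le> (\<Sum>a\<in>{0..N}. exp (11 * real N))"
      proof (rule sum_mono)
        fix a assume "a \<in> {0..N}"
        then have "real a * (exp 1 * 4 - 1 :: real) \<le> real N * 11"
          using exp_le exp1 by (intro mult_mono) auto
        then show "exp (exp 1 * 4 - 1 :: real) ^ a \<le> exp (11 * real N)"
          by (simp add: exp_of_nat_mult[symmetric] mult.commute)
      qed
      finally show ?thesis by (simp add: add.commute)
    qed
    have "W \<le> (real N + 1) * exp (11 * real N) + (real N + 1) * exp (11 * real N)"
      unfolding W_def by (intro add_mono S A B)
    also have "\<dots> = 2 * (real N + 1) * exp (11 * real N)" by simp
    also have "\<dots> \<le> exp (real N) * exp (real N) * exp (11 * real N)"
    proof (intro mult_right_mono mult_mono)
      show "2 \<le> exp (real N)" "real N + 1 \<le> exp (real N)"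
        using exp_ge_add_one_self[of "real N"] N by linarith+
    qed auto
    finally have "exp (- real K) * W \<le> exp (- real K) * (exp (real N) * exp (real N) * exp (11 * real N))"
      by (intro mult_left_mono) auto
    then show ?thesis by (simp add: K_def exp_add[symmetric])
  qed
  finally have "norm V \<le> exp (- 14 * T) + exp (- 13 * real N)" by simp
  also have "\<dots> \<le> exp (- 13 * T) + exp (- 13 * T)"
    using T1 TN by (intro add_mono) auto
  also have "\<dots> = 2 * exp (- T) * exp (- 12 * T)" by (simp add: exp_add[symmetric])
  also have "\<dots> < 1 * exp (- 12 * T)"
  proof (rule mult_strict_right_mono)
    \<comment> \<open>The linear bound \<open>1 + T \<le> exp T\<close> gives only
      \<open>2 \<le> exp T\<close> at \<open>T = 1\<close>; the quadratic term makes it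
      strict.\<close>
    have "0 < T\<^sup>2 / 2" using T1 by simp
    then have "2 < exp T" using exp_lower_Taylor_quadratic[of T] T1 by linarith
    then show "2 * exp (- T) < 1" by (simp add: exp_minus field_simps)
  qed simp
  finally show False using \<open>exp (- 12 * T) \<le> norm V\<close> by simp
qed

text \<open>Passing from sums to averages divides by \<open>k\<close>. Distinct rates force
  \<open>k \<le> N + 1\<close>, so this costs at most \<open>exp (4 * T)\<close>, whence 494 = 490 +
  4.\<close>

lemma poisson_mixtures_differ:
  fixes lam lam' :: "nat \<Rightarrow> nat" and k N :: nat
  defines "T \<equiv> real N powr (1/3)"
  assumes lam: "inj_on lam {1..k}" "lam ` {1..k} \<subseteq> {0..N}"
    and lam': "inj_on lam' {1..k}" "lam' ` {1..k} \<subseteq> {0..N}"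
    and neq: "lam ` {1..k} \<noteq> lam' ` {1..k}" and N: "N \<ge> 1" and k: "k \<ge> 1"
  shows "\<exists>x\<le>26 * N. exp (- 494 * T) \<le> \<bar>pmf (poisson_mixture k lam) x - pmf (poisson_mixture k lam') x\<bar>"
proof -
  obtain x where x: "x \<le> 26 * N" and
    D: "exp (- 490 * T) \<le> \<bar>(\<Sum>a\<in>lam ` {1..k}. pmf (Poi a) x) - (\<Sum>b\<in>lam' ` {1..k}. pmf (Poi b) x)\<bar>"
    using Poi_sums_differ[OF lam(2) lam'(2) neq N] unfolding T_def by blast
  have T1: "T \<ge> 1" using N by (simp add: T_def ge_one_powr_ge_zero)
  have T3: "T ^ 3 = real N" using N by (simp add: T_def powr_powr flip: powr_numeral)
  have "k \<le> N + 1" using card_inj_on_le[OF lam] by simp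
  then have "real k \<le> 2 * real N" using N by simp
  also have "\<dots> \<le> exp T * exp (3 * T)"
  proof (rule mult_mono)
    show "2 \<le> exp T" using exp_ge_add_one_self[of T] T1 by linarith
    have "T ^ 3 \<le> exp T ^ 3" using T1 exp_ge_add_one_self[of T] by (intro power_mono) linarith+
    then show "real N \<le> exp (3 * T)" by (simp add: T3 flip: exp_of_nat_mult)
  qed auto
  finally have kT: "real k \<le> exp (4 * T)" by (simp add: exp_add[symmetric])
  have "exp (- 494 * T) * real k \<le> exp (- 494 * T) * exp (4 * T)"
    using kT by (intro mult_left_mono) auto
  also have "\<dots> = exp (- 490 * T)" by (simp add: exp_add[symmetric])
  also note D
  also have "\<bar>(\<Sum>a\<in>lam ` {1..k}. pmf (Poi a) x) - (\<Sum>b\<in>lam' ` {1..k}. pmf (Poi b) x)\<bar>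
      = \<bar>pmf (poisson_mixture k lam) x - pmf (poisson_mixture k lam') x\<bar> * real k"
    unfolding pmf_poisson_mixture[OF k] sum.reindex[OF lam(1)] sum.reindex[OF lam'(1)] o_def
      right_diff_distrib[symmetric] abs_mult
    using k by simp
  finally show ?thesis using x k by auto
qed

section \<open>The estimator and its sample size\<close>

theorem theorem2:
  fixes \<delta> :: real
  assumes "0 < \<delta>" and "\<delta> < 1"
  shows "\<exists>C::real. C > 0 \<and>
    (\<forall>(N::nat) (k::nat). N \<ge> 1 \<longrightarrow> k \<ge> 1 \<longrightarrow>
      (\<forall>m::nat. real m \<ge> exp (C * real N powr (1/3)) \<longrightarrow>
        (\<exists>est :: nat list \<Rightarrow> nat set.
          \<forall>lam :: nat \<Rightarrow> nat.
            inj_on lam {1..k} \<longrightarrow> lam ` {1..k} \<subseteq> {0..N} \<longrightarrow>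
            measure_pmf.prob (replicate_pmf m (poisson_mixture k lam))
              {xs. est xs = lam ` {1..k}} \<ge> 1 - \<delta>)))"
\<comment> \<open>Here 990 = 2 * 495 provides the factor \<open>1 / \<eta>\<^sup>2\<close> in
  Chebyshev's bound, and \<open>ln (1 / \<delta>)\<close> the factor \<open>1 / \<delta>\<close>, as
  \<open>T \<ge> 1\<close>.\<close>
proof (intro exI[of _ "990 + ln (1 / \<delta>)"] conjI allI impI)
  have ln_pos: "ln (1 / \<delta>) > 0" using assms by (intro ln_gt_zero) auto
  then show "990 + ln (1 / \<delta>) > 0" by simp
  fix N k m :: nat
  assume N: "N \<ge> 1" and k: "k \<ge> 1" and m: "real m \<ge> exp ((990 + ln (1 / \<delta>)) * real N powr (1/3))"
  define T where "T = real N powr (1/3)"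
  \<comment> \<open>At most half the gap \<open>exp (- 494 * T)\<close>, because
    \<open>2 \<le> exp T\<close>.\<close>
  define \<eta> where "\<eta> = exp (- 495 * T)"
  have T1: "T \<ge> 1" using N by (simp add: T_def ge_one_powr_ge_zero)
  have "0 < real m" using m by (rule less_le_trans[OF exp_gt_zero])
  then have m1: "m \<ge> 1" by simp
  have m\<delta>: "1 / (real m * \<eta>\<^sup>2) \<le> \<delta>"
  proof -
    have "1 / \<delta> * exp (990 * T) = exp (ln (1 / \<delta>) * 1) * exp (990 * T)"
      using assms by simp
    also have "\<dots> \<le> exp (ln (1 / \<delta>) * T) * exp (990 * T)"
      using ln_pos T1 by (intro mult_right_mono exp_mono mult_left_mono) auto
    also have "\<dots> = exp ((990 + ln (1 / \<delta>)) * T)"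
      by (simp add: exp_add[symmetric] algebra_simps)
    also have "\<dots> \<le> real m" using m by (simp add: T_def)
    finally have "1 / \<delta> * exp (990 * T) * \<eta>\<^sup>2 \<le> real m * \<eta>\<^sup>2"
      by (intro mult_right_mono) auto
    moreover have "exp (990 * T) * \<eta>\<^sup>2 = 1"
      unfolding \<eta>_def exp_double[symmetric] exp_add[symmetric] by simp
    ultimately have "1 / \<delta> \<le> real m * \<eta>\<^sup>2" by (simp only: mult.assoc mult_1_right)
    moreover have "0 < real m * \<eta>\<^sup>2" using \<open>0 < real m\<close> by (simp add: \<eta>_def)
    ultimately show ?thesis using assms(1) by (simp add: divide_le_eq le_divide_eq mult.commute)
  qed
  have "2 * \<eta> \<le> exp T * \<eta>"
  proof (rule mult_right_mono)
    show "2 \<le> exp T" using exp_ge_add_one_self[of T] T1 by linarith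
  qed (simp add: \<eta>_def)
  then have \<eta>2: "2 * \<eta> \<le> exp (- 494 * T)" by (simp add: \<eta>_def exp_add[symmetric])
  define valid where "valid = (\<lambda>lam. inj_on lam {1..k} \<and> lam ` {1..k} \<subseteq> {0..N})"
  define close where "close = (\<lambda>lam xs. \<forall>x\<in>{..26 * N}.
    \<bar>real (count_list xs x) / real m - pmf (poisson_mixture k lam) x\<bar> < \<eta>)"
  \<comment> \<open>Any admissible rate vector that fits the empirical frequencies within
    \<open>\<eta>\<close> will do: two such vectors have the same rate set. Where none fits, the
    value is arbitrary; this happens only outside the event of closeness to the true
    mixture.\<close>
  define est where "est = (\<lambda>xs. (SOME lam. valid lam \<and> close lam xs) ` {1..k})"
  have est: "est xs = lam ` {1..k}" if "valid lam" "close lam xs" for lam xs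
  proof (rule ccontr)
    assume "est xs \<noteq> lam ` {1..k}"
    define lam' where "lam' = (SOME lam. valid lam \<and> close lam xs)"
    with \<open>est xs \<noteq> lam ` {1..k}\<close> have neq': "lam' ` {1..k} \<noteq> lam ` {1..k}"
      by (simp add: est_def)
    have "valid lam' \<and> close lam' xs"
      unfolding lam'_def using that by (intro someI[of "\<lambda>lam. valid lam \<and> close lam xs" lam] conjI)
    then obtain x where x: "x \<le> 26 * N"
      "exp (- 494 * T) \<le> \<bar>pmf (poisson_mixture k lam') x - pmf (poisson_mixture k lam) x\<bar>"
      using poisson_mixtures_differ[of lam' k N lam] neq' \<open>valid lam\<close> \<open>valid lam' \<and> close lam' xs\<close> N k
      unfolding valid_def T_def by blast
    then have "\<bar>real (count_list xs x) / real m - pmf (poisson_mixture k lam) x\<bar> < \<eta>"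
      "\<bar>real (count_list xs x) / real m - pmf (poisson_mixture k lam') x\<bar> < \<eta>"
      using that \<open>valid lam' \<and> close lam' xs\<close> by (auto simp: close_def)
    with x \<eta>2 show False by linarith
  qed
  have "measure_pmf.prob (replicate_pmf m (poisson_mixture k lam)) {xs. est xs = lam ` {1..k}} \<ge> 1 - \<delta>"
    if "valid lam" for lam
  proof -
    have "1 - \<delta> \<le> 1 - 1 / (real m * \<eta>\<^sup>2)" using m\<delta> by simp
    also have "\<dots> \<le> measure_pmf.prob (replicate_pmf m (poisson_mixture k lam)) {xs. close lam xs}"
      unfolding close_def using m1 by (intro prob_empirical_pmf_close) (auto simp: \<eta>_def)
    also have "\<dots> \<le> measure_pmf.prob (replicate_pmf m (poisson_mixture k lam)) {xs. est xs = lam ` {1..k}}"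
      using est[OF that] by (intro measure_pmf.finite_measure_mono) auto
    finally show ?thesis .
  qed
  then show "\<exists>est :: nat list \<Rightarrow> nat set. \<forall>lam :: nat \<Rightarrow> nat.
      inj_on lam {1..k} \<longrightarrow> lam ` {1..k} \<subseteq> {0..N} \<longrightarrow>
      measure_pmf.prob (replicate_pmf m (poisson_mixture k lam)) {xs. est xs = lam ` {1..k}} \<ge> 1 - \<delta>"
    unfolding valid_def by blast
qed

end
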